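(* Fix a value $z$ of the student observation $Z$. Let $R$ be the privileged context with conditional law $R\sim P(r\mid z)$, and for each context $r$ let $q(\cdot\mid z,r)$ be a probability distribution on the finite vocabulary $\mathcal V$ (the teacher's next-token distribution). Consider minimizing the expected forward KL divergence $$\mathbb{E}_{R\mid z}\big[\mathrm{KL}\big(q(\cdot\mid z,R)\,\|\,p(\cdot\mid z)\big)\big]$$ over all probability distributions $p(\cdot\mid z)$ on $\mathcal V$ (which depend on $z$ only and not on $R$). Then: (i) the minimizer is the mixture $p^\star(\cdot\mid z)=\mathbb{E}_{R\mid z}\big[q(\cdot\mid z,R)\big]$; (ii) the minimum value of the objective equals the conditional mutual information $I(A;R\mid Z=z)$, where, given $Z=z$, $R\sim P(\cdot\mid z)$ and $A\in\mathcal V$ is sampled from $q(\cdot\mid z,R)$; (iii) $H\big(p^\star(\cdot\mid z)\big)\;\ge\;\mathbb{E}_{R\mid z}\big[H\big(q(\cdot\mid z,R)\big)\big]$.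
   Context: $\mathcal V$ is a finite set (token vocabulary). The student observation is $z=(x,y_{<t})$, a problem $x$ together with a finite prefix $y_{<t}$ of tokens; for the result it is just a fixed value of a random variable $Z$. The privileged context $R$ is a random finite token string (so it takes values in a countable set), unavailable to the student. $\mathbb{E}_{R\mid z}$ is expectation under $R\sim P(\cdot\mid z)$; the mixture $\mathbb{E}_{R\mid z}[q(\cdot\mid z,R)]$ is the distribution $a\mapsto \mathbb{E}_{R\mid z}[q(a\mid z,R)]$ on $\mathcal V$. For distributions on $\mathcal V$, $\mathrm{KL}(q\,\|\,p)=\sum_{a\in\mathcal V} q(a)\log\frac{q(a)}{p(a)}$ and $H(p)=-\sum_{a\in\mathcal V} p(a)\log p(a)$, with the conventions $0\log 0=0$, $0\log(0/p)=0$ for every $p\ge 0$, and $\mathrm{KL}=+\infty$ if $q(a)>0=p(a)$ for some $a$. $I(A;R\mid Z=z)$ is the mutual information of $A$ and $R$ under their joint law conditional on $Z=z$. *)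

theory Defs
  imports "HOL-Probability.Probability"
begin

text \<open>
  Distributions on the vocabulary are pmfs over a finite type. The logarithm is natural
  throughout. Since \<open>0 * ln x = 0\<close> for every \<open>x\<close> (also for \<open>x = 0\<close> and for \<open>x = 0 / 0 = 0\<close>),
  the conventions \<open>0 log 0 = 0\<close> and \<open>0 log (0 / p) = 0\<close> hold automatically. The remaining case
  \<open>q(a) > 0 = p(a)\<close> has to be singled out, because \<open>ln (x / 0) = 0\<close> in HOL.
\<close>

definition pmf_entropy :: "'v::finite pmf \<Rightarrow> real" where
  "pmf_entropy p = - (\<Sum>a\<in>UNIV. pmf p a * ln (pmf p a))"

definition pmf_KL :: "'v::finite pmf \<Rightarrow> 'v pmf \<Rightarrow> ereal" where
  "pmf_KL q p =
     (if \<exists>a. pmf q a > 0 \<and> pmf p a = 0 then \<infinity>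
      else ereal (\<Sum>a\<in>UNIV. pmf q a * ln (pmf q a / pmf p a)))"

text \<open>
  The expectation of the extended-real-valued divergence is the Lebesgue integral of a
  nonnegative function; \<open>e2ennreal\<close> truncates nothing, by \<open>pmf_KL_nonneg\<close> below.
\<close>

definition expected_KL :: "'r pmf \<Rightarrow> ('r \<Rightarrow> 'v::finite pmf) \<Rightarrow> 'v pmf \<Rightarrow> ereal" where
  "expected_KL P q p = enn2ereal (\<integral>\<^sup>+ r. e2ennreal (pmf_KL (q r) p) \<partial>measure_pmf P)"

definition mixture :: "'r pmf \<Rightarrow> ('r \<Rightarrow> 'v pmf) \<Rightarrow> 'v pmf" where
  "mixture P q = bind_pmf P q"

text \<open>The joint law of \<open>(A, R)\<close> when \<open>R\<close> has law \<open>P\<close> and, given \<open>R = r\<close>, \<open>A\<close> has law \<open>q r\<close>.\<close>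

definition joint_law :: "'r pmf \<Rightarrow> ('r \<Rightarrow> 'v pmf) \<Rightarrow> ('v \<times> 'r) pmf" where
  "joint_law P q = bind_pmf P (\<lambda>r. map_pmf (\<lambda>a. (a, r)) (q r))"

definition mutual_info :: "('v \<times> 'r) pmf \<Rightarrow> real" where
  "mutual_info J =
     prob_space.mutual_information (measure_pmf J) (exp 1)
       (count_space UNIV) (count_space UNIV) fst snd"

lemma pmf_mixture: "pmf (mixture P q) a = measure_pmf.expectation P (\<lambda>r. pmf (q r) a)"
  by (simp add: mixture_def pmf_bind)

lemma pmf_joint_law: "pmf (joint_law P q) (a, r) = pmf P r * pmf (q r) a"
proof -
  have "pmf (map_pmf (\<lambda>b. (b, s)) (q s)) (a, r) = indicator {r} s * pmf (q r) a" for s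
  proof (cases "s = r")
    case True
    then show ?thesis
      using pmf_map_inj'[of "\<lambda>b. (b, r)" "q r" a] by (simp add: inj_on_def)
  next
    case False
    then show ?thesis by (auto simp: pmf_eq_0_set_pmf)
  qed
  then show ?thesis
    by (simp add: joint_law_def pmf_bind measure_pmf_single)
qed

lemma pmf_KL_nonneg: "0 \<le> pmf_KL q p"
proof (cases "\<exists>a. pmf q a > 0 \<and> pmf p a = 0")
  case True
  then show ?thesis by (simp add: pmf_KL_def)
next
  case False
  have *: "pmf q a - pmf p a \<le> pmf q a * ln (pmf q a / pmf p a)" for a
  proof (cases "pmf q a = 0")
    case True
    then show ?thesis by simp
  next
    case q0: False
    then have q: "pmf q a > 0" by (simp add: pmf_pos)
    with False have "pmf p a \<noteq> 0" by blast
    then have p: "pmf p a > 0" by (simp add: pmf_pos)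
    have "ln (pmf p a / pmf q a) \<le> pmf p a / pmf q a - 1"
      using p q by (intro ln_le_minus_one) simp
    then have "pmf q a * ln (pmf p a / pmf q a) \<le> pmf q a * (pmf p a / pmf q a - 1)"
      using q by (intro mult_left_mono) simp_all
    also have "\<dots> = pmf p a - pmf q a"
      using q by (simp add: field_simps)
    finally show ?thesis
      using p q by (simp add: ln_div algebra_simps)
  qed
  have "(\<Sum>a\<in>UNIV. pmf q a) - (\<Sum>a\<in>UNIV. pmf p a)
      \<le> (\<Sum>a\<in>UNIV. pmf q a * ln (pmf q a / pmf p a))"
    unfolding sum_subtractf[symmetric] by (intro sum_mono *)
  moreover have "(\<Sum>a\<in>UNIV. pmf q a) = 1" "(\<Sum>a\<in>UNIV. pmf p a) = 1"
    by (simp_all add: sum_pmf_eq_1)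
  ultimately have "0 \<le> (\<Sum>a\<in>UNIV. pmf q a * ln (pmf q a / pmf p a))"
    by simp
  then show ?thesis
    unfolding pmf_KL_def if_not_P[OF False] by simp
qed

end

theory Submission
  imports Defs
begin

text \<open>
  Everything follows from the compensation identity
  \<open>E KL(q(R) || p) = E KL(q(R) || m) + KL(m || p)\<close> for the mixture \<open>m\<close>, valid for every \<open>p\<close>
  (both sides are infinite when \<open>p\<close> does not dominate \<open>m\<close>). By Gibbs' inequality with its equality
  case, \<open>m\<close> is the unique minimizer, with value \<open>E KL(q(R) || m)\<close>. Fubini identifies this value with
  the mutual information, and expanding the logarithm writes it as \<open>H(m) - E H(q(R))\<close>.
\<close>

text \<open>The equality case of Gibbs' inequality: \<open>ln t \<le> t - 1\<close> is strict unless
  \<open>t = 1\<close>.\<close>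

lemma pmf_KL_eq_0_iff: "pmf_KL q p = 0 \<longleftrightarrow> q = p"
proof
  assume eq0: "pmf_KL q p = 0"
  then have dom: "pmf p a > 0" if "pmf q a > 0" for a
    using that by (auto simp: pmf_KL_def pmf_pos split: if_splits)
  have sum0: "(\<Sum>a\<in>UNIV. pmf q a * ln (pmf q a / pmf p a)) = 0"
    using eq0 by (auto simp: pmf_KL_def split: if_splits)
  \<comment> \<open>The correction \<open>pmf q a - pmf p a\<close> sums to zero because both masses
    are one, and it makes every single summand nonnegative.\<close>
  define gap where "gap a = pmf q a * ln (pmf q a / pmf p a) - (pmf q a - pmf p a)" for a
  have gap: "gap a \<ge> 0 \<and> (gap a = 0 \<longrightarrow> pmf q a = pmf p a)" for a
  proof (cases "pmf q a = 0")
    case True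
    then show ?thesis by (simp add: gap_def)
  next
    case False
    then have q: "pmf q a > 0" by (simp add: pmf_pos)
    with dom have p: "pmf p a > 0" by blast
    define t where "t = pmf p a / pmf q a"
    have t: "t > 0" using p q by (simp add: t_def)
    have "gap a = pmf q a * (t - 1 - ln t)"
      using p q by (simp add: gap_def t_def ln_div field_simps)
    moreover have "t = 1 \<longleftrightarrow> pmf q a = pmf p a"
      using q by (auto simp: t_def)
    ultimately show ?thesis
      using q t ln_le_minus_one[OF t] ln_eq_minus_one[OF t] by auto
  qed
  have "(\<Sum>a\<in>UNIV. gap a) = 0"
    using sum0 by (simp add: gap_def sum_subtractf sum_pmf_eq_1)
  then have "gap a = 0" for a
    using gap by (subst (asm) sum_nonneg_eq_0_iff) auto
  then show "q = p"
    using gap by (auto intro: pmf_eqI)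
next
  have "(\<Sum>a\<in>UNIV. pmf p a * ln (pmf p a / pmf p a)) = 0"
    by (intro sum.neutral) auto
  moreover assume "q = p"
  ultimately show "pmf_KL q p = 0"
    unfolding pmf_KL_def by auto
qed

text \<open>A bound free of \<open>x\<close>, so that the integrands below are bounded in the
  context even when there are infinitely many contexts. It rests on \<open>x * ln x\<close> lying
  between -1 and 0.\<close>

lemma abs_mult_ln_divide_le:
  fixes x c :: real
  assumes "0 \<le> x" "x \<le> 1" "0 \<le> c"
  shows "\<bar>x * ln (x / c)\<bar> \<le> 1 + \<bar>ln c\<bar>"
proof (cases "x = 0 \<or> c = 0")
  case True
  then show ?thesis by auto
next
  case False
  with assms have x: "0 < x" and c: "0 < c" by auto
  have "- ln x \<le> 1 / x - 1"
    using ln_le_minus_one[of "1 / x"] x by (simp add: ln_div)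
  then have "x * (- ln x) \<le> x * (1 / x - 1)"
    using x by (intro mult_left_mono) auto
  then have "- (x * ln x) \<le> 1" using x by (simp add: algebra_simps)
  moreover have "x * ln x \<le> 0"
    using x assms by (simp add: mult_nonneg_nonpos)
  moreover have "\<bar>x * ln c\<bar> \<le> \<bar>ln c\<bar>"
    using assms by (simp add: abs_mult mult_left_le_one_le)
  moreover have "x * ln (x / c) = x * ln x - x * ln c"
    using x c by (simp add: ln_div algebra_simps)
  ultimately show ?thesis by linarith
qed

lemma integrable_pmf_mult_ln:
  "integrable (measure_pmf P) (\<lambda>r. pmf (q r) a * ln (pmf (q r) a / pmf p a))"
proof (rule measure_pmf.integrable_const_bound)
  show "AE r in measure_pmf P. norm (pmf (q r) a * ln (pmf (q r) a / pmf p a)) \<le> 1 + \<bar>ln (pmf p a)\<bar>"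
    unfolding real_norm_def by (intro AE_I2 abs_mult_ln_divide_le) (auto simp: pmf_le_1)
qed simp

lemma integrable_pmf_mult_ln_self:
  "integrable (measure_pmf P) (\<lambda>r. pmf (q r) a * ln (pmf (q r) a))"
  \<comment> \<open>The point mass at \<open>a\<close> has value 1 there, so the quotient
    disappears.\<close>
  using integrable_pmf_mult_ln[of P q a "return_pmf a"] by simp

lemma integrable_pmf_apply: "integrable (measure_pmf P) (\<lambda>r. pmf (q r) a)"
  by (rule measure_pmf.integrable_const_bound[where B = 1]) (auto simp: pmf_le_1)

lemma pmf_mixture_pos_iff: "pmf (mixture P q) a > 0 \<longleftrightarrow> (\<exists>r\<in>set_pmf P. pmf (q r) a > 0)"
  by (auto simp: pmf_positive_iff mixture_def)

lemma pmf_mixture_eq_0D: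
  "pmf (mixture P q) a = 0 \<Longrightarrow> r \<in> set_pmf P \<Longrightarrow> pmf (q r) a = 0"
  using pmf_mixture_pos_iff[of P q a] by (metis order_less_irrefl pmf_pos)

text \<open>Domination of the mixture passes to \<open>q r\<close> for every \<open>r\<close> in the
  support of \<open>P\<close>, so the infinite branch of \<open>pmf_KL\<close> has probability zero
  and the integral is a real one.\<close>

lemma expected_KL_dominated:
  assumes "\<And>a. pmf p a = 0 \<Longrightarrow> pmf (mixture P q) a = 0"
  shows "expected_KL P q p =
    ereal (\<Sum>a\<in>UNIV. measure_pmf.expectation P (\<lambda>r. pmf (q r) a * ln (pmf (q r) a / pmf p a)))"
proof -
  let ?f = "\<lambda>r. \<Sum>a\<in>UNIV. pmf (q r) a * ln (pmf (q r) a / pmf p a)"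
  have KL: "pmf_KL (q r) p = ereal (?f r)" if "r \<in> set_pmf P" for r
    using assms pmf_mixture_eq_0D[OF _ that] by (force simp: pmf_KL_def)
  have nonneg: "0 \<le> ?f r" if "r \<in> set_pmf P" for r
    using pmf_KL_nonneg[of "q r" p] KL[OF that] by simp
  have "(\<integral>\<^sup>+ r. e2ennreal (pmf_KL (q r) p) \<partial>measure_pmf P) = (\<integral>\<^sup>+ r. ennreal (?f r) \<partial>measure_pmf P)"
    by (intro nn_integral_cong_AE) (auto simp: AE_measure_pmf_iff KL)
  also have "\<dots> = ennreal (measure_pmf.expectation P ?f)"
    by (intro nn_integral_eq_integral) (auto simp: AE_measure_pmf_iff nonneg integrable_pmf_mult_ln)
  finally have "expected_KL P q p = ereal (measure_pmf.expectation P ?f)"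
    using nonneg by (simp add: expected_KL_def integral_nonneg_AE AE_measure_pmf_iff)
  then show ?thesis
    by (simp add: Bochner_Integration.integral_sum integrable_pmf_mult_ln)
qed

text \<open>A single context of positive probability with infinite divergence already makes the
  expectation infinite.\<close>

lemma expected_KL_not_dominated:
  assumes "pmf (mixture P q) a > 0" "pmf p a = 0"
  shows "expected_KL P q p = \<infinity>"
proof -
  obtain r where r: "r \<in> set_pmf P" "pmf (q r) a > 0"
    using assms(1) by (auto simp: pmf_mixture_pos_iff)
  then have inf: "e2ennreal (pmf_KL (q r) p) = \<infinity>"
    using assms(2) by (auto simp: pmf_KL_def)
  have "(\<integral>\<^sup>+ r. e2ennreal (pmf_KL (q r) p) \<partial>measure_pmf P) = \<infinity>"
  proof (rule ccontr)
    assume "\<not> ?thesis"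
    then have "AE r in measure_pmf P. e2ennreal (pmf_KL (q r) p) \<noteq> \<infinity>"
      by (intro nn_integral_PInf_AE) auto
    with r inf show False by (auto simp: AE_measure_pmf_iff)
  qed
  then show ?thesis by (simp add: expected_KL_def)
qed

lemma expected_KL_mixture:
  "expected_KL P q (mixture P q) = ereal (\<Sum>a\<in>UNIV. measure_pmf.expectation P
     (\<lambda>r. pmf (q r) a * ln (pmf (q r) a / pmf (mixture P q) a)))"
  by (rule expected_KL_dominated)

text \<open>The part containing \<open>p\<close> is linear in \<open>q r\<close>, so its expectation
  sees only the mixture; the other part is the same for all \<open>p\<close>.\<close>

lemma expectation_pmf_mult_ln_divide:
  assumes "pmf p a = 0 \<Longrightarrow> pmf (mixture P q) a = 0"
  shows "measure_pmf.expectation P (\<lambda>r. pmf (q r) a * ln (pmf (q r) a / pmf p a))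
    = measure_pmf.expectation P (\<lambda>r. pmf (q r) a * ln (pmf (q r) a))
      - pmf (mixture P q) a * ln (pmf p a)" (is "?lhs = _")
proof -
  \<comment> \<open>Off the support of \<open>P\<close> this can fail, since
    \<open>pmf p a = 0\<close> may meet \<open>pmf (q r) a > 0\<close>; hence the almost-everywhere
    congruence afterwards.\<close>
  have "pmf (q r) a * ln (pmf (q r) a / pmf p a)
      = pmf (q r) a * ln (pmf (q r) a) - pmf (q r) a * ln (pmf p a)"
    if r: "r \<in> set_pmf P" for r
  proof (cases "pmf (q r) a = 0")
    case False
    then have "pmf p a \<noteq> 0"
      using pmf_mixture_eq_0D[OF assms r] by blast
    with False show ?thesis
      by (simp add: ln_div right_diff_distrib)
  qed simp
  then have "?lhs = measure_pmf.expectation P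
      (\<lambda>r. pmf (q r) a * ln (pmf (q r) a) - pmf (q r) a * ln (pmf p a))"
    by (intro integral_cong_AE) (auto simp: AE_measure_pmf_iff)
  then show ?thesis
    by (simp add: integrable_pmf_mult_ln_self integrable_pmf_apply pmf_mixture)
qed

lemma expected_KL_compensation:
  "expected_KL P q p = expected_KL P q (mixture P q) + pmf_KL (mixture P q) p"
proof (cases "\<exists>a. pmf (mixture P q) a > 0 \<and> pmf p a = 0")
  case True
  then show ?thesis
    by (auto simp: expected_KL_not_dominated pmf_KL_def expected_KL_mixture)
next
  case False
  let ?m = "mixture P q"
  have dom: "pmf ?m a = 0" if "pmf p a = 0" for a
    using False that pmf_pos[of ?m a] by blast
  have "pmf ?m a * ln (pmf ?m a / pmf p a) = pmf ?m a * ln (pmf ?m a) - pmf ?m a * ln (pmf p a)" for a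
    using dom[of a] by (cases "pmf ?m a = 0") (auto simp: ln_div right_diff_distrib)
  \<comment> \<open>The expectations of \<open>q ln q\<close> on both sides cancel, and so do the
    two terms \<open>m ln m\<close> for the mixture \<open>m\<close>.\<close>
  then have "measure_pmf.expectation P (\<lambda>r. pmf (q r) a * ln (pmf (q r) a / pmf p a))
      = measure_pmf.expectation P (\<lambda>r. pmf (q r) a * ln (pmf (q r) a / pmf ?m a))
        + pmf ?m a * ln (pmf ?m a / pmf p a)" for a
    using dom[of a] by (simp add: expectation_pmf_mult_ln_divide)
  then show ?thesis
    using False by (simp add: expected_KL_dominated[OF dom] expected_KL_mixture pmf_KL_def sum.distrib)
qed

lemma expected_KL_mixture_entropy:
  "expected_KL P q (mixture P q) =
    ereal (pmf_entropy (mixture P q) - measure_pmf.expectation P (\<lambda>r. pmf_entropy (q r)))"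
  by (simp add: expected_KL_mixture expectation_pmf_mult_ln_divide pmf_entropy_def sum_subtractf
      Bochner_Integration.integral_sum integrable_pmf_mult_ln_self)

lemma mutual_info_eq_integral:
  fixes J :: "('v::countable \<times> 'r::countable) pmf"
  shows "mutual_info J = (\<integral>x. pmf J x * ln (pmf J x / (pmf (map_pmf fst J) (fst x) * pmf (map_pmf snd J) (snd x)))
    \<partial>(count_space UNIV \<Otimes>\<^sub>M count_space UNIV))"
proof -
  interpret information_space "measure_pmf J" "exp 1"
    by standard simp
  \<comment> \<open>Countability makes the product of counting measures a counting measure, so
    \<open>pmf J\<close> is the joint density.\<close>
  have pair: "count_space UNIV \<Otimes>\<^sub>M count_space UNIV = (count_space UNIV :: ('v \<times> 'r) measure)"
    by (simp add: pair_measure_countable)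
  have dist: "distributed (measure_pmf J) (count_space UNIV) X (pmf (map_pmf X J))" for X :: "'v \<times> 'r \<Rightarrow> 'b"
    by (simp add: distributed_def map_pmf_rep_eq[symmetric] measure_pmf_eq_density[symmetric])
  have "distributed (measure_pmf J) (count_space UNIV \<Otimes>\<^sub>M count_space UNIV) (\<lambda>x. (fst x, snd x)) (pmf J)"
    using dist[of "\<lambda>x. x"] by (simp add: pair)
  from mutual_information_distr[OF _ _ dist _ dist _ this] show ?thesis
    by (simp add: mutual_info_def sigma_finite_measure_count_space log_def)
qed

lemma map_fst_joint_law: "map_pmf fst (joint_law P q) = mixture P q"
  by (simp add: joint_law_def mixture_def map_bind_pmf pmf.map_comp comp_def)

lemma map_snd_joint_law: "map_pmf snd (joint_law P q) = P"
  by (simp add: joint_law_def map_bind_pmf pmf.map_comp comp_def map_pmf_const bind_return_pmf')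

text \<open>The factor \<open>pmf P r\<close> cancels inside the logarithm and remains outside as
  the weight of the expectation.\<close>

lemma mutual_info_joint_law:
  fixes P :: "'r::countable pmf" and q :: "'r \<Rightarrow> 'v::finite pmf"
  shows "mutual_info (joint_law P q) = (\<Sum>a\<in>UNIV. measure_pmf.expectation P
     (\<lambda>r. pmf (q r) a * ln (pmf (q r) a / pmf (mixture P q) a)))"
proof -
  let ?m = "mixture P q"
  let ?V = "count_space (UNIV :: 'v set)" and ?R = "count_space (UNIV :: 'r set)"
  let ?g = "\<lambda>a r. pmf (q r) a * ln (pmf (q r) a / pmf ?m a)"
  let ?f = "\<lambda>x. pmf P (snd x) * ?g (fst x) (snd x)"
  interpret pair_sigma_finite ?V ?R
    by (simp add: pair_sigma_finite_def sigma_finite_measure_count_space)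
  have int: "integrable ?R (\<lambda>r. pmf P r * ?g a r)" for a
    using integrable_pmf_mult_ln[of P q a ?m]
    unfolding measure_pmf_eq_density by (subst (asm) integrable_density) auto
  have "integrable (?V \<Otimes>\<^sub>M ?R) ?f"
  \<comment> \<open>The outer variable ranges over a finite type, so integrability of each section
    in \<open>r\<close> suffices.\<close>
  proof (rule Fubini_integrable)
    show "?f \<in> borel_measurable (?V \<Otimes>\<^sub>M ?R)"
      by (simp add: pair_measure_countable)
  qed (use int in \<open>auto intro: integrable_count_space\<close>)
  note fubini = integral_fst'[OF this]
  \<comment> \<open>Contexts of mass zero are treated apart: nothing cancels there, but both sides
    vanish.\<close>
  have "pmf (joint_law P q) x * ln (pmf (joint_law P q) x / (pmf ?m (fst x) * pmf P (snd x))) = ?f x" for x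
    by (cases x; cases "pmf P (snd x) = 0") (auto simp: pmf_joint_law)
  then have "mutual_info (joint_law P q) = integral\<^sup>L (?V \<Otimes>\<^sub>M ?R) ?f"
    by (simp add: mutual_info_eq_integral map_fst_joint_law map_snd_joint_law)
  also have "\<dots> = (\<Sum>a\<in>UNIV. \<integral>r. pmf P r * ?g a r \<partial>?R)"
    by (simp add: fubini[symmetric] lebesgue_integral_count_space_finite)
  also have "\<dots> = (\<Sum>a\<in>UNIV. measure_pmf.expectation P (?g a))"
    unfolding measure_pmf_eq_density by (subst integral_density) auto
  finally show ?thesis .
qed

theorem proposition1:
  fixes z :: 'z
    and P :: "'z \<Rightarrow> ('r::countable) pmf"
    and q :: "'z \<Rightarrow> 'r \<Rightarrow> ('v::finite) pmf"
  shows "(\<forall>p. is_arg_min (expected_KL (P z) (q z)) (\<lambda>_. True) p \<longleftrightarrow> p = mixture (P z) (q z))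
    \<and> (INF p. expected_KL (P z) (q z) p) = ereal (mutual_info (joint_law (P z) (q z)))
    \<and> measure_pmf.expectation (P z) (\<lambda>r. pmf_entropy (q z r))
        \<le> pmf_entropy (mixture (P z) (q z))"
proof (intro conjI allI)
  let ?m = "mixture (P z) (q z)" and ?E = "expected_KL (P z) (q z)"
  let ?I = "mutual_info (joint_law (P z) (q z))"
  have I: "?E ?m = ereal ?I"
    by (simp add: expected_KL_mixture mutual_info_joint_law)
  have E: "?E p = ereal ?I + pmf_KL ?m p" for p
    using expected_KL_compensation[of "P z" "q z" p] by (simp add: I)
  have le: "?E ?m \<le> ?E p" for p
    using pmf_KL_nonneg[of ?m p] unfolding I E[of p] by (simp add: add_increasing2)
  have less: "?E ?m < ?E p" if "p \<noteq> ?m" for p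
  proof -
    have "pmf_KL ?m p \<noteq> 0" using that by (auto simp: pmf_KL_eq_0_iff)
    \<comment> \<open>The minimum is a finite real, so adding a nonzero divergence changes
      it.\<close>
    then have "?E p \<noteq> ?E ?m"
      unfolding I E[of p] by (cases "pmf_KL ?m p") (auto simp: zero_ereal_def)
    with le[of p] show ?thesis by order
  qed
  show "is_arg_min ?E (\<lambda>_. True) p \<longleftrightarrow> p = ?m" for p
    using le less[of p] by (auto simp: is_arg_min_def not_less[symmetric] simp del: not_less)
  show "(INF p. ?E p) = ereal ?I"
    unfolding I[symmetric] using le by (intro antisym INF_lower INF_greatest) auto
  \<comment> \<open>The entropy gap is the minimum value itself, and an expected divergence is
    nonnegative.\<close>
  have "0 \<le> ?E ?m"
    by (simp add: expected_KL_def)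
  then show "measure_pmf.expectation (P z) (\<lambda>r. pmf_entropy (q z r)) \<le> pmf_entropy ?m"
    by (simp add: expected_KL_mixture_entropy)
qed

end
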